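(* Let $q\ge 0$ be an integer, put $d=7+2q$, and let $T\in\mathbb{P}(\mathrm{Sym}^d(\mathbb{C}^3))$ be a ternary form of degree $d$. Let $A=\{P_1,\dots,P_r\}\subset\mathbb{P}^2$ be a minimal decomposition of $T$ of length $r=\ell(A)=3q+10$ such that: (1) $A$ is contained in a plane cubic curve $C$; (2) the Kruskal's rank of $A$ is $k_1(A)=3$, and the $(q+3)$-th Kruskal's rank of $A$ is $k_{q+3}(A)=3q+9$. Then there exists no second minimal decomposition $B$ of $T$ (i.e. no minimal decomposition $B\subset\mathbb{P}^2$ of $T$ with $B\ne A$) of length $\ell(B)\le 3q+10$.
   Context: We work over $\mathbb{C}$. For a finite set $A\subset\mathbb{P}^n=\mathbb{P}(\mathbb{C}^{n+1})$, $\ell(A)$ denotes its cardinality. $v_d:\mathbb{P}^n\to\mathbb{P}^N$, $N=\binom{n+d}{d}-1$, is the Veronese embedding of degree $d$, and $\mathbb{P}^N$ is identified with $\mathbb{P}(\mathrm{Sym}^d(\mathbb{C}^{n+1}))$, so that points of $\mathbb{P}^N$ are (nonzero) forms of degree $d$ in $n+1$ variables up to scalar; identifying points of $\mathbb{P}^n$ with linear forms $L$ up to scalar, $v_d$ sends $L$ to $L^d$. A finite set $A\subset\mathbb{P}^n$ is a decomposition of $T\in\mathbb{P}(\mathrm{Sym}^d(\mathbb{C}^{n+1}))$ if $T\in\langle v_d(A)\rangle$, the linear span of the points of $v_d(A)$; $\ell(A)$ is the length of the decomposition. The decomposition $A$ is minimal (non-redundant) if $T\notin\langle v_d(A')\rangle$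 for every proper subset $A'\subset A$. A finite set of points in projective space is linearly independent if representative vectors are linearly independent. The Kruskal's rank of a finite set of points in a projective space is the maximum $k$ such that every subset of cardinality $\le k$ is linearly independent. The $d$-th Kruskal's rank $k_d(A)$ of a finite set $A\subset\mathbb{P}^n$ is the Kruskal's rank of $v_d(A)$; $k_1(A)$ is the Kruskal's rank of $A$. *)

theory Defs
  imports "HOL-Analysis.Analysis" "HOL-Library.Poly_Mapping"
begin

subsection \<open>Projective spaces\<close>

text \<open>Points of a projective space are the lines through the origin of a vector space,
  encoded as sets of vectors.\<close>

context vector_space
begin

definition projectivization :: "'b set \<Rightarrow> 'b set set" where
  "projectivization V = {local.span {v} |v. v \<in> V \<and> v \<noteq> 0}"

definition proj_span :: "'b set set \<Rightarrow> 'b set set" where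
  "proj_span X = local.projectivization (local.span (\<Union>X))"

text \<open>Since \<^term>\<open>p = span {rep p}\<close>, a choice of representatives is automatically injective.\<close>

definition proj_independent :: "'b set set \<Rightarrow> bool" where
  "proj_independent X \<longleftrightarrow> (\<exists>rep. (\<forall>p\<in>X. p = local.span {rep p}) \<and> local.independent (rep ` X))"

text \<open>The bound \<^term>\<open>k \<le> card X\<close> makes the maximum exist also when all of \<^term>\<open>X\<close> is
  independent; the Kruskal rank is then \<^term>\<open>card X\<close>. Meant for finite \<^term>\<open>X\<close>.\<close>

definition kruskal_rank :: "'b set set \<Rightarrow> nat" where
  "kruskal_rank X =
     Max {k. k \<le> card X \<and> (\<forall>Y. Y \<subseteq> X \<and> card Y \<le> k \<longrightarrow> local.proj_independent Y)}"

end


subsection \<open>Forms\<close>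

text \<open>Polynomials with variables indexed by \<^typ>\<open>'n\<close>: finitely supported maps from exponent
  vectors to coefficients, with the convolution product of \<^theory>\<open>HOL-Library.Poly_Mapping\<close>.\<close>

type_synonym 'n cpoly = "('n \<Rightarrow>\<^sub>0 nat) \<Rightarrow>\<^sub>0 complex"

definition poly_scale :: "complex \<Rightarrow> 'n cpoly \<Rightarrow> 'n cpoly" where
  "poly_scale c f = Poly_Mapping.map ((*) c) f"

lemma lookup_poly_scale [simp]:
  "Poly_Mapping.lookup (poly_scale c f) m = c * Poly_Mapping.lookup f m"
  by (simp add: poly_scale_def Poly_Mapping.map.rep_eq when_def)

global_interpretation form: vector_space poly_scale
  by unfold_locales (auto intro!: poly_mapping_eqI simp: lookup_add algebra_simps)

definition forms :: "nat \<Rightarrow> ('n::finite) cpoly set" where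
  "forms d = {f. \<forall>m \<in> Poly_Mapping.keys f. (\<Sum>i\<in>UNIV. Poly_Mapping.lookup m i) = d}"

definition poly_eval :: "('n::finite) cpoly \<Rightarrow> complex ^ 'n \<Rightarrow> complex" where
  "poly_eval f x = (\<Sum>m\<in>Poly_Mapping.keys f.
     Poly_Mapping.lookup f m * (\<Prod>i\<in>UNIV. (x $ i) ^ Poly_Mapping.lookup m i))"

abbreviation proj_space :: "(complex ^ 'n) set set" where
  "proj_space \<equiv> vec.projectivization UNIV"

definition hypersurface :: "('n::finite) cpoly \<Rightarrow> (complex ^ 'n) set set" where
  "hypersurface f = {p \<in> proj_space. \<forall>x\<in>p. poly_eval f x = 0}"

text \<open>No irreducibility or reducedness is required of the curve.\<close>

definition plane_curve :: "nat \<Rightarrow> (complex ^ 3) set set \<Rightarrow> bool" where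
  "plane_curve e C \<longleftrightarrow> (\<exists>f \<in> forms e. f \<noteq> 0 \<and> C = hypersurface f)"


subsection \<open>Veronese embeddings and decompositions\<close>

definition linear_form :: "complex ^ 'n \<Rightarrow> ('n::finite) cpoly" where
  "linear_form a =
     (\<Sum>i\<in>UNIV. Poly_Mapping.single (Poly_Mapping.single i 1) (a $ i))"

text \<open>A point of projective space is identified with a linear form up to scalar by its
  coordinates, and \<open>[L]\<close> is sent to \<open>[L ^ d]\<close>. The span of the \<open>d\<close>-th powers of all vectors
  of a line is again a line, see \<open>veronese_span\<close> below.\<close>

definition veronese :: "nat \<Rightarrow> (complex ^ 'n) set \<Rightarrow> ('n::finite) cpoly set" where
  "veronese d p = form.span ((\<lambda>a. linear_form a ^ d) ` p)"

lemma linear_form_scale: "linear_form (c *s a) = poly_scale c (linear_form a)"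
  by (rule poly_mapping_eqI)
    (simp add: linear_form_def lookup_sum lookup_single when_def sum_distrib_left if_distrib
      cong: if_cong)

lemma poly_scale_eq: "poly_scale c f = Poly_Mapping.single 0 c * f"
  by (rule poly_mapping_eqI) (simp add: mult_map_scale_conv_mult[symmetric] poly_scale_def)

lemma poly_scale_power: "poly_scale c f ^ d = poly_scale (c ^ d) (f ^ d)"
  by (induction d) (auto simp: poly_scale_eq algebra_simps mult_single)

lemma veronese_span: "veronese d (vec.span {a}) = form.span {linear_form a ^ d}"
proof -
  have "(\<lambda>x. linear_form x ^ d) ` vec.span {a} \<subseteq> form.span {linear_form a ^ d}"
    by (auto simp: vec.span_singleton linear_form_scale poly_scale_power form.span_singleton)
  moreover have "{linear_form a ^ d} \<subseteq> (\<lambda>x. linear_form x ^ d) ` vec.span {a}"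
    by (auto intro: vec.span_base)
  ultimately show ?thesis unfolding veronese_def
    by (metis form.span_mono form.span_minimal form.subspace_span subset_antisym)
qed

definition decomposition ::
    "nat \<Rightarrow> ('n::finite) cpoly set \<Rightarrow> (complex ^ 'n) set set \<Rightarrow> bool" where
  "decomposition d T A \<longleftrightarrow>
     finite A \<and> A \<subseteq> proj_space \<and> T \<in> form.proj_span (veronese d ` A)"

definition minimal_decomposition ::
    "nat \<Rightarrow> ('n::finite) cpoly set \<Rightarrow> (complex ^ 'n) set set \<Rightarrow> bool" where
  "minimal_decomposition d T A \<longleftrightarrow>
     decomposition d T A \<and> (\<forall>A'. A' \<subset> A \<longrightarrow> T \<notin> form.proj_span (veronese d ` A'))"

definition kruskal_rank_deg :: "nat \<Rightarrow> (complex ^ 'n) set set \<Rightarrow> nat" where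
  "kruskal_rank_deg d A = form.kruskal_rank (veronese d ` A :: ('n::finite) cpoly set set)"

end

theory Submission
  imports Defs
begin

text \<open>Let \<open>e = q + 3\<close>, so that \<open>d = 2 e + 1\<close>, and write \<open>L\<^sub>p\<close> for a linear form representing the
  point \<open>p\<close>. Since the Kruskal rank of \<open>A\<close> in degree \<open>e\<close> is one less than its cardinality, the powers
  \<open>L\<^sub>p ^ e\<close> with \<open>p \<in> A\<close> form a circuit: they satisfy a single linear relation \<open>\<lambda>\<close>, up to scalars, and
  \<open>\<lambda>\<close> has no zero coefficient. Since the Kruskal rank in degree 1 is three, a line contains at most two
  points of \<open>A\<close>. The locale \<open>plane_circuit\<close> collects these facts.

  The main device is contraction. If \<open>\<Sum> c\<^sub>p L\<^sub>p ^ (a + b) = 0\<close> and \<open>g\<close> is a form of degree \<open>a\<close>, then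
  \<open>\<Sum> c\<^sub>p g(p) L\<^sub>p ^ b = 0\<close>. Contraction by a line through suitable points turns a relation in degree
  \<open>e + 1\<close> into one in degree \<open>e\<close> supported on \<open>A\<close>, which must be a multiple of \<open>\<lambda>\<close>. This gives two facts
  about degree \<open>e + 1\<close>. The set \<open>A\<close> together with one more point is independent
  (\<open>insert_independent\<close>). If \<open>A\<close> becomes dependent after adding two points \<open>P, P'\<close>, then the relation
  is \<open>\<lambda> / l\<close> on \<open>A\<close>, up to a scalar, where \<open>l\<close> is an equation of the line \<open>P P'\<close>
  (\<open>two_extra_points\<close>).

  Let \<open>B\<close> be another decomposition with at most as many points. Subtracting the two expressions of \<open>T\<close>
  gives a relation \<open>c\<close> in degree \<open>2 e + 1\<close> on \<open>A \<union> B\<close>, with nonzero coefficients on \<open>A - B\<close>. A form \<open>g\<close>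
  of degree \<open>e + 1\<close> that vanishes on \<open>B\<close> contracts \<open>c\<close> to a relation in degree \<open>e\<close> on \<open>A\<close>. So if \<open>g\<close> also
  vanishes at one point of \<open>A\<close>, then it vanishes on all of \<open>A\<close>. Dually, the powers \<open>L\<^sub>p ^ (e + 1)\<close> with
  \<open>p \<in> A \<union> B\<close> span a space of dimension at most \<open>card B + 1 < card A + 2\<close>. Therefore \<open>A\<close> does become
  dependent in degree \<open>e + 1\<close> after adding any two points of \<open>B - A\<close> (\<open>two_points_dependent\<close>).

  Suppose that \<open>B - A\<close> contains three points not on a line, and let \<open>l\<^sub>1, l\<^sub>2, l\<^sub>3\<close> be the sides of the
  triangle. The relations of the form \<open>\<lambda> / l\<^sub>i\<close> on \<open>A\<close> can be combined so that
  \<open>1 / l\<^sub>3 - t / l\<^sub>2 = s / l\<^sub>1\<close> holds on \<open>A\<close>. This puts \<open>A\<close> on a rational conic, where forms of degree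
  \<open>e\<close> restrict to a space of dimension at most \<open>2 e + 1\<close>. But \<open>A\<close> has at least \<open>2 e + 3\<close> points and is a
  circuit, a contradiction (\<open>not_on_parametrised_conic\<close>).

  Hence \<open>B - A\<close> lies on a line \<open>l\<close>. Contracting \<open>c\<close> by \<open>l\<close> leaves a relation on \<open>A\<close> in degree \<open>2 e\<close>,
  where \<open>A\<close> is independent, so \<open>A - B\<close> lies on \<open>l\<close> as well and has at most two points. The same bound
  follows for \<open>B - A\<close>, and then \<open>c\<close> is a relation between at most four powers of degree \<open>2 e + 1\<close>, hence
  zero. So \<open>A - B\<close> is empty and \<open>B = A\<close>.\<close>

section \<open>Linear algebra\<close>

lemma (in vector_space) exists_functional_separating:
  assumes "x \<notin> span S"
  shows "\<exists>\<phi>. (\<forall>u v. \<phi> (u + v) = \<phi> u + \<phi> v) \<and> (\<forall>c v. \<phi> (scale c v) = c * \<phi> v)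
    \<and> (\<forall>s\<in>S. \<phi> s = 0) \<and> \<phi> x = (1::'a)"
proof -
  interpret vector_space_pair scale "(*) :: 'a \<Rightarrow> 'a \<Rightarrow> 'a"
    by unfold_locales
  obtain B where B: "B \<subseteq> S" "independent B" "S \<subseteq> span B"
    using maximal_independent_subset[of S] by metis
  have sB: "span B = span S"
    using B by (metis span_eq span_superset subset_trans)
  have xB: "independent (insert x B)" "x \<notin> B"
    using B(2) assms sB by (auto simp: independent_insert span_base)
  obtain \<phi> where lin: "Vector_Spaces.linear scale (*) \<phi>"
    and \<phi>: "\<forall>b\<in>insert x B. \<phi> b = (if b = x then 1 else 0)"
    using linear_independent_extend[OF xB(1), of "\<lambda>b. if b = x then 1 else 0"] by blast
  interpret \<phi>: Vector_Spaces.linear scale "(*)" \<phi> by (fact lin)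
  note add = \<phi>.add and sc = \<phi>.scale
  have z: "\<phi> 0 = 0" using add[of 0 0] by simp
  have "\<phi> s = 0" if "s \<in> S" for s
  proof -
    have "s \<in> span B" using B(3) that by blast
    then show ?thesis
      by (induction rule: span_induct_alt) (use \<phi> xB(2) z in \<open>auto simp: add sc\<close>)
  qed
  then show ?thesis using add sc \<phi> by (intro exI[of _ \<phi>]) auto
qed

text \<open>The vectors are indexed by points, and \<open>w\<close> may repeat a value: a repetition is itself a relation.
  This saves proving that the powers in question are distinct.\<close>

lemma (in vector_space) exists_linear_relation:
  assumes "finite X" "finite K" "card K < card X" "\<And>x. x \<in> X \<Longrightarrow> w x \<in> span K"
  shows "\<exists>c. (\<exists>x\<in>X. c x \<noteq> 0) \<and> (\<Sum>x\<in>X. scale (c x) (w x)) = 0"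
proof (cases "inj_on w X")
  case True
  then have "card (w ` X) = card X" by (rule card_image)
  then have "dependent (w ` X)"
    using independent_span_bound[OF assms(2), of "w ` X"] assms by (auto simp: image_subset_iff)
  then obtain u where u: "\<exists>v\<in>w ` X. u v \<noteq> 0" "(\<Sum>v\<in>w ` X. scale (u v) v) = 0"
    using dependent_finite[of "w ` X"] assms(1) by auto
  then show ?thesis
    by (intro exI[of _ "u \<circ> w"]) (auto simp: sum.reindex[OF True])
next
  case False
  then obtain x y where xy: "x \<in> X" "y \<in> X" "x \<noteq> y" "w x = w y" by (auto simp: inj_on_def)
  define c where "c = (\<lambda>z. if z = x then 1 else if z = y then -1 else 0 :: 'a)"
  have "(\<Sum>z\<in>X. scale (c z) (w z)) = (\<Sum>z\<in>{x, y}. scale (c z) (w z))"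
    using xy assms(1) by (intro sum.mono_neutral_right) (auto simp: c_def)
  also have "\<dots> = 0" using xy by (simp add: c_def)
  finally show ?thesis using xy by (intro exI[of _ c]) (auto simp: c_def)
qed

section \<open>Representatives and linear functionals\<close>

definition rep_vec :: "(complex ^ 'n) set \<Rightarrow> complex ^ 'n" where
  "rep_vec p = (SOME v. v \<noteq> 0 \<and> p = vec.span {v})"

lemma rep_vec:
  assumes "p \<in> proj_space"
  shows "rep_vec p \<noteq> 0" "vec.span {rep_vec p} = p"
proof -
  have "\<exists>v. v \<noteq> 0 \<and> p = vec.span {v}"
    using assms by (auto simp: vec.projectivization_def)
  from someI_ex[OF this] show "rep_vec p \<noteq> 0" "vec.span {rep_vec p} = p"
    unfolding rep_vec_def by auto
qed

definition linear_functional :: "complex ^ 'n \<Rightarrow> complex ^ ('n::finite) \<Rightarrow> complex" where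
  "linear_functional a x = (\<Sum>i\<in>UNIV. a $ i * x $ i)"

lemma linear_functional_zero [simp]: "linear_functional a 0 = 0"
  by (simp add: linear_functional_def)

lemma linear_functional_add:
  "linear_functional a (x + y) = linear_functional a x + linear_functional a y"
  by (simp add: linear_functional_def algebra_simps sum.distrib)

lemma linear_functional_scale:
  "linear_functional a (c *s x) = c * linear_functional a x"
  by (simp add: linear_functional_def algebra_simps sum_distrib_left)

text \<open>Duality with the linear forms of the ambient space: this is the source of all lines through given
  points that avoid another point.\<close>

lemma exists_linear_functional:
  fixes x :: "complex ^ 'n::finite"
  assumes "x \<notin> vec.span S"
  shows "\<exists>a. (\<forall>s\<in>S. linear_functional a s = 0) \<and> linear_functional a x = 1"
proof -
  obtain \<phi> where \<phi>: "\<And>u v. \<phi> (u + v) = \<phi> u + \<phi> v" "\<And>c v. \<phi> (c *s v) = c * \<phi> v"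
    "\<forall>s\<in>S. \<phi> s = 0" "\<phi> x = 1"
    using vec.exists_functional_separating[OF assms] by auto
  have z: "\<phi> 0 = 0" using \<phi>(1)[of 0 0] by simp
  have sm: "\<phi> (sum f I) = (\<Sum>i\<in>I. \<phi> (f i))" if "finite I" for f and I :: "'n set"
    using that by (induction I) (auto simp: \<phi> z)
  have "linear_functional (\<chi> i. \<phi> (axis i 1)) v = \<phi> v" for v
  proof -
    have "\<phi> v = \<phi> (\<Sum>i\<in>UNIV. v $ i *s axis i 1)" by (simp add: basis_expansion)
    also have "\<dots> = linear_functional (\<chi> i. \<phi> (axis i 1)) v"
      by (subst sm) (auto simp: \<phi> linear_functional_def mult.commute)
    finally show ?thesis ..
  qed
  then show ?thesis using \<phi> by (intro exI[of _ "\<chi> i. \<phi> (axis i 1)"]) auto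
qed

section \<open>Relations between powers of linear forms\<close>

text \<open>The multinomial coefficient of the monomial \<open>m\<close> in the \<open>e\<close>-th power of a sum of the variables, by
  the recursion that multiplying by the sum of the variables gives. Only its vanishing matters.\<close>

fun power_coeff :: "nat \<Rightarrow> (('n::finite) \<Rightarrow>\<^sub>0 nat) \<Rightarrow> nat" where
  "power_coeff 0 m = (if m = 0 then 1 else 0)"
| "power_coeff (Suc e) m = (\<Sum>i\<in>UNIV. if Poly_Mapping.lookup m i = 0 then 0
      else power_coeff e (m - Poly_Mapping.single i 1))"

abbreviation total_degree :: "(('n::finite) \<Rightarrow>\<^sub>0 nat) \<Rightarrow> nat" where
  "total_degree m \<equiv> \<Sum>i\<in>UNIV. Poly_Mapping.lookup m i"

definition monomial_value :: "(('n::finite) \<Rightarrow>\<^sub>0 nat) \<Rightarrow> complex ^ 'n \<Rightarrow> complex" where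
  "monomial_value m x = (\<Prod>i\<in>UNIV. (x $ i) ^ Poly_Mapping.lookup m i)"

lemma total_degree_add_single:
  "total_degree (m + Poly_Mapping.single (i::'n::finite) 1) = Suc (total_degree m)"
  by (simp add: lookup_add sum.distrib lookup_single when_def)

lemma minus_single_add:
  fixes m :: "'n \<Rightarrow>\<^sub>0 nat"
  assumes "Poly_Mapping.lookup m i \<noteq> 0"
  shows "m - Poly_Mapping.single i 1 + Poly_Mapping.single i 1 = m"
  using assms by (intro poly_mapping_eqI) (auto simp: lookup_add lookup_minus lookup_single when_def)

lemma total_degree_eq_0: "total_degree m = 0 \<longleftrightarrow> m = 0"
  by (auto intro: poly_mapping_eqI)

lemma monomial_value_add_single:
  "monomial_value (m + Poly_Mapping.single i 1) x = x $ i * monomial_value m x"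
proof -
  have "monomial_value (m + Poly_Mapping.single i 1) x =
    (\<Prod>j\<in>UNIV. (x $ j) ^ Poly_Mapping.lookup m j) * (\<Prod>j\<in>UNIV. if j = i then x $ j else 1)"
    unfolding monomial_value_def prod.distrib[symmetric]
    by (intro prod.cong) (auto simp: lookup_add lookup_single power_add when_def)
  then show ?thesis by (simp add: monomial_value_def)
qed

lemma power_coeff_nonzero_iff: "power_coeff e m \<noteq> 0 \<longleftrightarrow> total_degree m = e"
proof (induction e arbitrary: m)
  case 0 then show ?case using total_degree_eq_0[of m] by simp
next
  case (Suc e)
  have *: "total_degree m = Suc (total_degree (m - Poly_Mapping.single i 1))"
    if "Poly_Mapping.lookup m i \<noteq> 0" for i
    using minus_single_add[OF that] total_degree_add_single[of "m - Poly_Mapping.single i 1" i] by simp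
  have **: "power_coeff e (m - Poly_Mapping.single i 1) \<noteq> 0 \<longleftrightarrow> total_degree m = Suc e"
    if "Poly_Mapping.lookup m i \<noteq> 0" for i
    unfolding Suc.IH *[OF that] by simp
  have "power_coeff (Suc e) m \<noteq> 0 \<longleftrightarrow>
     (\<exists>i. Poly_Mapping.lookup m i \<noteq> 0 \<and> power_coeff e (m - Poly_Mapping.single i 1) \<noteq> 0)"
    by auto
  also have "\<dots> \<longleftrightarrow> (\<exists>i. Poly_Mapping.lookup m i \<noteq> 0 \<and> total_degree m = Suc e)"
    using ** by blast
  also have "\<dots> \<longleftrightarrow> total_degree m = Suc e"
  proof -
    have "\<exists>i. Poly_Mapping.lookup m i \<noteq> 0" if "total_degree m = Suc e"
      by (rule ccontr) (use that in simp)
    then show ?thesis by blast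
  qed
  finally show ?case .
qed

lemma lookup_single_times:
  fixes f :: "'n cpoly"
  shows "Poly_Mapping.lookup (Poly_Mapping.single (Poly_Mapping.single i 1) c * f) m =
    (if Poly_Mapping.lookup m i = 0 then 0
     else c * Poly_Mapping.lookup f (m - Poly_Mapping.single i 1))"
proof -
  let ?s = "Poly_Mapping.single i (1::nat)"
  have "Poly_Mapping.lookup (Poly_Mapping.single ?s c * f) m =
     Sum_any (\<lambda>l. (c when ?s = l) * Sum_any (\<lambda>q. Poly_Mapping.lookup f q when m = l + q))"
    by (simp add: lookup_mult lookup_single)
  also have "\<dots> = Sum_any (\<lambda>l. (c * Sum_any (\<lambda>q. Poly_Mapping.lookup f q when m = ?s + q)) when l = ?s)"
    by (intro Sum_any.cong) (auto simp: when_def)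
  also have "\<dots> = c * Sum_any (\<lambda>q. Poly_Mapping.lookup f q when m = ?s + q)" by simp
  also have "Sum_any (\<lambda>q. Poly_Mapping.lookup f q when m = ?s + q) =
     (if Poly_Mapping.lookup m i = 0 then 0 else Poly_Mapping.lookup f (m - ?s))"
  proof (cases "Poly_Mapping.lookup m i = 0")
    case True
    then have "m \<noteq> ?s + q" for q by (auto simp: lookup_add)
    then show ?thesis using True by simp
  next
    case False
    then have "m = ?s + q \<longleftrightarrow> q = m - ?s" for q
      using minus_single_add[OF False] by (metis add.commute add_diff_cancel_right')
    then show ?thesis using False by simp
  qed
  finally show ?thesis by simp
qed

lemma lookup_linear_form_power:
  "Poly_Mapping.lookup (linear_form a ^ e) m = of_nat (power_coeff e m) * monomial_value m a"
proof (induction e arbitrary: m)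
  case 0
  then show ?case
    by (simp add: lookup_one monomial_value_def when_def)
next
  case (Suc e)
  have mv: "monomial_value m a = a $ i * monomial_value (m - Poly_Mapping.single i 1) a"
    if "Poly_Mapping.lookup m i \<noteq> 0" for i
    using minus_single_add[OF that] monomial_value_add_single[of "m - Poly_Mapping.single i 1" i a] by simp
  have "Poly_Mapping.lookup (linear_form a ^ Suc e) m = (\<Sum>i\<in>UNIV. if Poly_Mapping.lookup m i = 0 then 0
      else a $ i * Poly_Mapping.lookup (linear_form a ^ e) (m - Poly_Mapping.single i 1))"
    by (subst power_Suc, subst linear_form_def, simp only: sum_distrib_right lookup_sum lookup_single_times)
  also have "\<dots> = (\<Sum>i\<in>UNIV. of_nat (if Poly_Mapping.lookup m i = 0 then 0
      else power_coeff e (m - Poly_Mapping.single i 1)) * monomial_value m a)"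
    by (intro sum.cong) (auto simp: Suc.IH mv)
  also have "\<dots> = of_nat (power_coeff (Suc e) m) * monomial_value m a"
    by (simp only: power_coeff.simps of_nat_sum sum_distrib_right)
  finally show ?case .
qed

definition power_relation ::
  "nat \<Rightarrow> (complex ^ 'n) set set \<Rightarrow> ((complex ^ ('n::finite)) set \<Rightarrow> complex) \<Rightarrow> bool" where
  "power_relation e X c \<longleftrightarrow> (\<Sum>p\<in>X. poly_scale (c p) (linear_form (rep_vec p) ^ e)) = 0"

text \<open>In characteristic zero the multinomial coefficients of degree \<open>e\<close> can be cancelled. What remains
  says that \<open>c\<close> annihilates the values of all monomials of degree \<open>e\<close>, a condition that can be
  multiplied by forms.\<close>

lemma power_relation_iff_moments:
  "power_relation e X c \<longleftrightarrow>
     (\<forall>m. total_degree m = e \<longrightarrow> (\<Sum>p\<in>X. c p * monomial_value m (rep_vec p)) = 0)"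
proof -
  have "power_relation e X c \<longleftrightarrow>
     (\<forall>m. (\<Sum>p\<in>X. c p * (of_nat (power_coeff e m) * monomial_value m (rep_vec p))) = 0)"
    by (simp add: power_relation_def poly_mapping_eq_iff fun_eq_iff lookup_sum lookup_linear_form_power)
  also have "\<dots> \<longleftrightarrow>
     (\<forall>m. of_nat (power_coeff e m) * (\<Sum>p\<in>X. c p * monomial_value m (rep_vec p)) = 0)"
    by (simp add: sum_distrib_left algebra_simps)
  also have "\<dots> \<longleftrightarrow>
     (\<forall>m. total_degree m = e \<longrightarrow> (\<Sum>p\<in>X. c p * monomial_value m (rep_vec p)) = 0)"
    unfolding power_coeff_nonzero_iff[symmetric] mult_eq_0_iff of_nat_eq_0_iff
    by (intro arg_cong[of _ _ All] ext) auto
  finally show ?thesis .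
qed

text \<open>Contraction by a linear form: in terms of moments, a monomial of degree \<open>e\<close> times the linear form is a
  combination of monomials of degree \<open>e + 1\<close>.\<close>

lemma power_relation_times_linear:
  assumes "power_relation (Suc e) X c"
  shows "power_relation e X (\<lambda>p. c p * linear_functional a (rep_vec p))"
  unfolding power_relation_iff_moments
proof (intro allI impI)
  fix m :: "'a \<Rightarrow>\<^sub>0 nat" assume m: "total_degree m = e"
  have "(\<Sum>p\<in>X. c p * linear_functional a (rep_vec p) * monomial_value m (rep_vec p)) =
    (\<Sum>p\<in>X. \<Sum>i\<in>UNIV. a $ i * (c p * monomial_value (m + Poly_Mapping.single i 1) (rep_vec p)))"
    by (simp add: linear_functional_def monomial_value_add_single sum_distrib_left sum_distrib_right mult_ac
      del: One_nat_def)
  also have "\<dots> = (\<Sum>i\<in>UNIV. a $ i * (\<Sum>p\<in>X. c p * monomial_value (m + Poly_Mapping.single i 1) (rep_vec p)))"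
    by (subst sum.swap) (simp add: sum_distrib_left)
  also have "\<dots> = 0"
    using assms m total_degree_add_single[of m] unfolding power_relation_iff_moments
    by (simp del: One_nat_def)
  finally show "(\<Sum>p\<in>X. c p * linear_functional a (rep_vec p) * monomial_value m (rep_vec p)) = 0" .
qed

text \<open>Forms as functions on vectors. They are generated by products of linear functionals, because
  contraction by a form is then an induction over contractions by linear functionals.\<close>

inductive homogeneous :: "nat \<Rightarrow> (complex ^ ('n::finite) \<Rightarrow> complex) \<Rightarrow> bool" where
  const: "homogeneous 0 (\<lambda>x. c)"
| linear: "homogeneous e g \<Longrightarrow> homogeneous (Suc e) (\<lambda>x. linear_functional a x * g x)"
| add: "homogeneous e g \<Longrightarrow> homogeneous e h \<Longrightarrow> homogeneous e (\<lambda>x. g x + h x)"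

lemma power_relation_add:
  "power_relation e X c \<Longrightarrow> power_relation e X c' \<Longrightarrow> power_relation e X (\<lambda>p. c p + c' p)"
  by (simp add: power_relation_def form.scale_left_distrib sum.distrib)

lemma power_relation_scale:
  "power_relation e X c \<Longrightarrow> power_relation e X (\<lambda>p. k * c p)"
  unfolding power_relation_def form.scale_scale[symmetric] form.scale_sum_right[symmetric] by simp

lemma power_relation_times_homogeneous:
  assumes "homogeneous e g" "power_relation (e + k) X c"
  shows "power_relation k X (\<lambda>p. c p * g (rep_vec p))"
  using assms
proof (induction arbitrary: c rule: homogeneous.induct)
  case (const b)
  then show ?case using power_relation_scale[of k X c b] by (simp only: mult.commute[of b] add_0)
next
  case (linear e g a)
  have "power_relation (Suc (e + k)) X c" using linear.prems by simp
  from linear.IH[OF power_relation_times_linear[OF this, of a]] show ?case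
    by (simp only: mult.assoc)
next
  case (add e g h)
  from power_relation_add[OF add.IH(1)[OF add.prems] add.IH(2)[OF add.prems]] show ?case
    by (simp only: distrib_left)
qed

lemma homogeneous_sum:
  assumes "finite I" "I \<noteq> {}" "\<And>i. i \<in> I \<Longrightarrow> homogeneous e (g i)"
  shows "homogeneous e (\<lambda>x. \<Sum>i\<in>I. g i x)"
  using assms
proof (induction I rule: finite_ne_induct)
  case (singleton i)
  then show ?case by simp
next
  case (insert i I)
  have "homogeneous e (g i)" "homogeneous e (\<lambda>x. \<Sum>i\<in>I. g i x)"
    using insert.IH insert.prems by simp_all
  from homogeneous.add[OF this] show ?case
    using insert.hyps by simp
qed

text \<open>Every linear functional on the space of forms of degree \<open>e\<close> is, on \<open>e\<close>-th powers, the evaluation of a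
  form of degree \<open>e\<close> (apolarity). Writing one factor of the power as \<open>\<Sum> x\<^sub>i X\<^sub>i\<close> moves the variable
  \<open>X\<^sub>i\<close> into the functional, which is why the induction is over all functionals.\<close>

lemma homogeneous_functional_power:
  assumes "\<And>u v. \<phi> (u + v) = \<phi> u + \<phi> v" "\<And>c v. \<phi> (poly_scale c v) = c * \<phi> v"
  shows "homogeneous e (\<lambda>x :: complex ^ ('n::finite). \<phi> (linear_form x ^ e))"
  using assms
proof (induction e arbitrary: \<phi>)
  case 0
  then show ?case by (simp add: homogeneous.const)
next
  case (Suc e)
  note add = Suc.prems(1) and scale = Suc.prems(2)
  have z: "\<phi> 0 = 0" using add[of 0 0] by simp
  have sm: "\<phi> (sum f I) = (\<Sum>i\<in>I. \<phi> (f i))" if "finite I" for f and I :: "'n set"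
    using that by (induction I) (auto simp: add z)
  let ?X = "\<lambda>i::'n. Poly_Mapping.single (Poly_Mapping.single i 1) (1::complex)"
  have eq: "\<phi> (linear_form x ^ Suc e) =
     (\<Sum>i\<in>UNIV. linear_functional (axis i 1) x * \<phi> (?X i * linear_form x ^ e))" for x
  proof -
    have "linear_form x ^ Suc e = (\<Sum>i\<in>UNIV. poly_scale (x $ i) (?X i * linear_form x ^ e))"
      by (subst power_Suc, subst linear_form_def)
        (simp add: sum_distrib_right poly_scale_eq mult_single mult.assoc[symmetric])
    moreover have "linear_functional (axis i 1) x = x $ i" for i
      by (simp add: linear_functional_def axis_def if_distrib[of "\<lambda>z. z * _"] cong: if_cong)
    ultimately show ?thesis by (simp add: sm scale)
  qed
  have "homogeneous e (\<lambda>x. \<phi> (?X i * linear_form x ^ e))" for i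
  proof (rule Suc.IH)
    show "\<phi> (?X i * (u + v)) = \<phi> (?X i * u) + \<phi> (?X i * v)" for u v
      by (simp only: distrib_left add)
    show "\<phi> (?X i * poly_scale c v) = c * \<phi> (?X i * v)" for c v
      by (simp only: poly_scale_eq mult.left_commute[of "?X i"]) (simp only: poly_scale_eq[symmetric] scale)
  qed
  then show ?case unfolding eq
    by (intro homogeneous_sum[OF finite UNIV_not_empty] homogeneous.linear)
qed

section \<open>Few points and forms through given points\<close>

lemma rep_vec_notin_span:
  assumes "p \<in> proj_space" "p' \<in> proj_space" "p \<noteq> p'"
  shows "rep_vec p' \<notin> vec.span {rep_vec p}"
proof
  assume "rep_vec p' \<in> vec.span {rep_vec p}"
  then obtain k where k: "rep_vec p' = k *s rep_vec p" by (auto simp: vec.span_singleton)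
  then have "k \<noteq> 0" using rep_vec(1)[OF assms(2)] by auto
  then have "rep_vec p = inverse k *s rep_vec p'" by (simp add: k vector_smult_assoc)
  then have "rep_vec p \<in> vec.span {rep_vec p'}" by (auto simp: vec.span_singleton)
  then have "vec.span {rep_vec p} = vec.span {rep_vec p'}"
    using \<open>rep_vec p' \<in> vec.span {rep_vec p}\<close> by (auto simp: vec.span_eq)
  then show False using rep_vec(2)[OF assms(1)] rep_vec(2)[OF assms(2)] assms(3) by simp
qed

lemma linear_form_power_nonzero:
  assumes "a \<noteq> 0"
  shows "linear_form a ^ e \<noteq> 0"
proof -
  obtain i where i: "a $ i \<noteq> 0" using assms by (auto simp: vec_eq_iff)
  let ?m = "Poly_Mapping.single i e"
  have "total_degree ?m = e" by (simp add: lookup_single when_def)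
  then have "power_coeff e ?m \<noteq> 0" by (simp only: power_coeff_nonzero_iff)
  moreover have "monomial_value ?m a = (\<Prod>j\<in>UNIV. if j = i then (a $ j) ^ e else 1)"
    unfolding monomial_value_def by (intro prod.cong) (auto simp: lookup_single when_def)
  ultimately have "Poly_Mapping.lookup (linear_form a ^ e) ?m \<noteq> 0"
    unfolding lookup_linear_form_power using i by simp
  then show ?thesis by auto
qed

lemma power_relation_restrict_iff:
  assumes "finite X" "Y \<subseteq> X" "\<And>p. p \<in> X - Y \<Longrightarrow> c p = 0"
  shows "power_relation e X c \<longleftrightarrow> power_relation e Y c"
  unfolding power_relation_def using assms
  by (subst sum.mono_neutral_right[of X Y]) auto

lemma power_relation_restrict:
  assumes "power_relation e X c" "finite X" "Y \<subseteq> X" "\<And>p. p \<in> X - Y \<Longrightarrow> c p = 0"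
  shows "power_relation e Y c"
  using power_relation_restrict_iff[of X Y c e] assms by blast

text \<open>Contracting by lines that avoid \<open>p\<close> and pass through the other points, one at a time, removes all
  terms except that of \<open>p\<close>.\<close>

lemma power_relation_few_points:
  assumes "finite X" "X \<subseteq> proj_space" "card X \<le> Suc e" "power_relation e X c" "p \<in> X"
  shows "c p = 0"
  using assms
proof (induction e arbitrary: X c)
  case 0
  then have "X = {p}" using card_le_Suc0_iff_eq[of X] by auto
  then show ?case using 0 by (auto simp: power_relation_def)
next
  case (Suc e)
  show ?case
  proof (cases "X = {p}")
    case True
    have "linear_form (rep_vec p) ^ Suc e \<noteq> 0"
      using linear_form_power_nonzero rep_vec(1)[of p] Suc.prems by blast
    then show ?thesis using True Suc.prems by (auto simp: power_relation_def)
  next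
    case False
    then obtain p' where p': "p' \<in> X" "p' \<noteq> p" using Suc.prems by blast
    obtain a where a: "linear_functional a (rep_vec p') = 0" "linear_functional a (rep_vec p) = 1"
      using exists_linear_functional[OF rep_vec_notin_span[of p' p]] p' Suc.prems by auto
    define c' where "c' = (\<lambda>q. c q * linear_functional a (rep_vec q))"
    have "power_relation e X c'"
      using power_relation_times_linear Suc.prems by (auto simp: c'_def)
    then have "power_relation e (X - {p'}) c'"
    proof (rule power_relation_restrict)
      show "c' q = 0" if "q \<in> X - (X - {p'})" for q
      proof -
        have "q = p'" using that by blast
        then show ?thesis using a by (simp add: c'_def)
      qed
    qed (use Suc.prems in simp_all)
    moreover have "p \<in> X - {p'}" "X - {p'} \<subseteq> proj_space" "card (X - {p'}) \<le> Suc e"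
      using Suc.prems p' by (simp, blast, simp)
    ultimately have "c' p = 0" using Suc.IH[of "X - {p'}" c'] Suc.prems(1) by blast
    then show ?thesis using a by (simp add: c'_def)
  qed
qed

lemma exists_line_through:
  fixes x y :: "complex ^ 3"
  shows "\<exists>a. a \<noteq> 0 \<and> linear_functional a x = 0 \<and> linear_functional a y = 0"
proof -
  have "vec.dim {x, y} \<le> card {x, y}" by (rule vec.dim_le_card) (auto intro: vec.span_base)
  then have "vec.dim {x, y} < 3" using card_insert_le_m1[of 2 "{y}" x]
    by (auto simp: card_insert_if split: if_splits)
  then have "vec.span {x, y} \<noteq> (UNIV :: (complex ^ 3) set)"
    using vec_dim_card[where 'n=3 and 'a=complex] vec.dim_span[of "{x, y}"] by force
  then obtain z where "z \<notin> vec.span {x, y}" by blast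
  from exists_linear_functional[OF this] obtain a where
    "\<forall>s\<in>{x, y}. linear_functional a s = 0" "linear_functional a z = 1" by blast
  then show ?thesis by (intro exI[of _ a]) (auto simp: linear_functional_def)
qed

text \<open>The dual description of a span of powers: a power lies in the span of others if every form that
  vanishes at the other points vanishes at its point too.\<close>

lemma exists_homogeneous_separating:
  assumes "linear_form x ^ e \<notin> form.span ((\<lambda>y. linear_form y ^ e) ` S)"
  shows "\<exists>g. homogeneous e g \<and> (\<forall>y\<in>S. g y = 0) \<and> g x \<noteq> 0"
proof -
  obtain \<phi> where \<phi>: "\<And>u v. \<phi> (u + v) = \<phi> u + \<phi> v" "\<And>c v. \<phi> (poly_scale c v) = c * \<phi> v"
    "\<forall>s\<in>(\<lambda>y. linear_form y ^ e) ` S. \<phi> s = 0" "\<phi> (linear_form x ^ e) = 1"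
    using form.exists_functional_separating[OF assms] by auto
  have "homogeneous e (\<lambda>y. \<phi> (linear_form y ^ e))"
    by (rule homogeneous_functional_power) (auto simp: \<phi>)
  then show ?thesis using \<phi>(3,4) by (intro exI[of _ "\<lambda>y. \<phi> (linear_form y ^ e)"]) auto
qed

lemma homogeneous_linear_power: "homogeneous k (\<lambda>x. linear_functional a x ^ k)"
proof (induction k)
  case 0 then show ?case using homogeneous.const[of 1] by simp
next
  case (Suc k) from homogeneous.linear[OF this, of a] show ?case by simp
qed

lemma linear_form_add: "linear_form (x + y) = linear_form x + linear_form y"
  by (simp add: linear_form_def single_add sum.distrib)

lemma linear_form_zero [simp]: "linear_form 0 = 0"
  by (simp add: linear_form_def)

lemma linear_form_sum:
  "finite I \<Longrightarrow> linear_form (\<Sum>i\<in>I. f i) = (\<Sum>i\<in>I. linear_form (f i))"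
  by (induction I rule: finite_induct) (simp_all add: linear_form_add)

lemma dual_basis_expansion:
  assumes "vec.independent {x1, x2, x3}" "x1 \<noteq> x2" "x1 \<noteq> x3" "x2 \<noteq> x3"
    and span: "vec.span {x1, x2, x3} = (UNIV :: (complex ^ 'n) set)"
  obtains a1 a2 a3 where
    "linear_functional a1 x1 = 1" "linear_functional a1 x2 = 0" "linear_functional a1 x3 = 0"
    "linear_functional a2 x1 = 0" "linear_functional a2 x2 = 1" "linear_functional a2 x3 = 0"
    "linear_functional a3 x1 = 0" "linear_functional a3 x2 = 0" "linear_functional a3 x3 = 1"
    "\<forall>v. v = linear_functional a1 v *s x1 + linear_functional a2 v *s x2 + linear_functional a3 v *s x3"
proof -
  have *: "y \<notin> vec.span ({x1, x2, x3} - {y})" if "y \<in> {x1, x2, x3}" for y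
    using assms(1) that unfolding vec.dependent_def by blast
  have "x1 \<notin> vec.span {x2, x3}" "x2 \<notin> vec.span {x1, x3}" "x3 \<notin> vec.span {x1, x2}"
    using *[of x1] *[of x2] *[of x3] assms(2-4) by (simp_all add: insert_Diff_if)
  then obtain a1 a2 a3 where a:
    "\<forall>s\<in>{x2, x3}. linear_functional a1 s = 0" "linear_functional a1 x1 = 1"
    "\<forall>s\<in>{x1, x3}. linear_functional a2 s = 0" "linear_functional a2 x2 = 1"
    "\<forall>s\<in>{x1, x2}. linear_functional a3 s = 0" "linear_functional a3 x3 = 1"
    using exists_linear_functional by metis
  have "v = linear_functional a1 v *s x1 + linear_functional a2 v *s x2 + linear_functional a3 v *s x3" for v
  proof -
    have "v \<in> vec.span {x1, x2, x3}" using span by simp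
    then obtain k1 k2 where "v - k1 *s x1 - k2 *s x2 \<in> vec.span {x3}"
      by (auto simp: vec.span_insert[of x1] vec.span_insert[of x2])
    then obtain k3 where "v - k1 *s x1 - k2 *s x2 = k3 *s x3" by (auto simp: vec.span_singleton)
    then have v: "v = k1 *s x1 + k2 *s x2 + k3 *s x3" by (simp add: algebra_simps)
    have "linear_functional a1 v = k1" "linear_functional a2 v = k2" "linear_functional a3 v = k3"
      unfolding v using a by (simp_all add: linear_functional_add linear_functional_scale)
    then show ?thesis using v by simp
  qed
  with a show ?thesis by (intro that[of a1 a2 a3]) auto
qed

section \<open>Circuits in the plane without three collinear points\<close>

text \<open>The set \<open>A\<close> in degree \<open>e\<close>, with its relation \<open>lam\<close>. The condition \<open>few_on_line\<close> says that no three
  points of \<open>A\<close> are collinear. By \<open>circuit\<close>, every proper subset of \<open>A\<close> is independent, and all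
  relations are multiples of \<open>lam\<close>. Together with this,
  \<open>card_ge\<close> excludes that \<open>A\<close> lies on a smooth conic, and \<open>degree_ge\<close> makes any four points
  independent in degree \<open>e + 1\<close>.\<close>

locale plane_circuit =
  fixes e :: nat and A :: "(complex ^ 3) set set" and lam :: "(complex ^ 3) set \<Rightarrow> complex"
  assumes finite: "finite A" and proj: "A \<subseteq> proj_space"
    and degree_ge: "2 \<le> e" and card_ge: "2 * e + 3 \<le> card A"
    and few_on_line: "\<And>a. a \<noteq> 0 \<Longrightarrow> card {p \<in> A. linear_functional a (rep_vec p) = 0} \<le> 2"
    and relation: "power_relation e A lam"
    and lam_nonzero: "\<And>p. p \<in> A \<Longrightarrow> lam p \<noteq> 0"
    and circuit: "\<And>c p q. power_relation e A c \<Longrightarrow> p \<in> A \<Longrightarrow> c p = 0 \<Longrightarrow> q \<in> A \<Longrightarrow> c q = 0"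
begin

text \<open>Contract by the line through \<open>P\<close> and some point of \<open>A\<close>. The result is a relation in degree \<open>e\<close> on
  \<open>A\<close> with a zero coefficient, so it is zero. Hence \<open>c\<close> is supported on \<open>P\<close> and the at most two points of
  \<open>A\<close> on that line, and three points are independent. The point \<open>P\<close> may belong to \<open>A\<close>.\<close>

lemma insert_independent:
  assumes P: "P \<in> proj_space" and c: "power_relation (Suc e) (insert P A) c" and Q: "Q \<in> insert P A"
  shows "c Q = 0"
proof -
  have "\<not> A \<subseteq> {P}"
    using card_mono[of "{P}" A] card_ge by auto
  then obtain Q0 where Q0: "Q0 \<in> A" "Q0 \<noteq> P" by blast
  obtain a where a: "a \<noteq> 0" "linear_functional a (rep_vec P) = 0" "linear_functional a (rep_vec Q0) = 0"
    using exists_line_through by blast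
  let ?l = "\<lambda>q. linear_functional a (rep_vec q)"
  have "power_relation e (insert P A) (\<lambda>q. c q * ?l q)"
    by (rule power_relation_times_linear[OF c])
  then have "power_relation e A (\<lambda>q. c q * ?l q)"
    by (rule power_relation_restrict) (use finite a in auto)
  from circuit[OF this Q0(1)] a have z: "c q = 0 \<or> ?l q = 0" if "q \<in> A" for q
    using that by simp
  define S where "S = insert P {q \<in> A. ?l q = 0}"
  have "power_relation (Suc e) S c"
    by (rule power_relation_restrict[OF c]) (use finite z in \<open>auto simp: S_def\<close>)
  moreover have "card S \<le> Suc (Suc e)"
    using card_insert_le_m1[of 3 "{q \<in> A. ?l q = 0}" P] few_on_line[OF a(1)] degree_ge
    by (auto simp: S_def)
  ultimately have "c q = 0" if "q \<in> S" for q
    using power_relation_few_points[of S "Suc e" c q] that finite proj P by (auto simp: S_def)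
  then show ?thesis using z Q by (auto simp: S_def)
qed

text \<open>Here the contraction is by the line through both extra points. If the resulting multiple of \<open>lam\<close>
  were zero, then \<open>c\<close> would be supported on at most four points.\<close>

lemma two_extra_points:
  assumes P: "P \<in> proj_space - A" "P' \<in> proj_space - A" "P \<noteq> P'"
    and a: "a \<noteq> 0" "linear_functional a (rep_vec P) = 0" "linear_functional a (rep_vec P') = 0"
    and c: "power_relation (Suc e) (insert P (insert P' A)) c"
    and nz: "\<exists>Q \<in> insert P (insert P' A). c Q \<noteq> 0"
  shows "c P \<noteq> 0" "c P' \<noteq> 0"
    "\<exists>\<mu>. \<mu> \<noteq> 0 \<and> (\<forall>Q\<in>A. c Q * linear_functional a (rep_vec Q) = \<mu> * lam Q)"
proof -
  let ?X = "insert P (insert P' A)"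
  let ?l = "\<lambda>q. linear_functional a (rep_vec q)"
  show "c P \<noteq> 0"
  proof
    assume 0: "c P = 0"
    then have "power_relation (Suc e) (insert P' A) c"
      by (intro power_relation_restrict[OF c]) (use finite in auto)
    then show False using insert_independent[of P' c] P nz 0 by auto
  qed
  show "c P' \<noteq> 0"
  proof
    assume 0: "c P' = 0"
    then have "power_relation (Suc e) (insert P A) c"
      by (intro power_relation_restrict[OF c]) (use finite in auto)
    then show False using insert_independent[of P c] P nz 0 by auto
  qed
  have "power_relation e ?X (\<lambda>q. c q * ?l q)"
    by (rule power_relation_times_linear[OF c])
  then have rel: "power_relation e A (\<lambda>q. c q * ?l q)"
    by (rule power_relation_restrict) (use finite a in auto)
  obtain Q0 where Q0: "Q0 \<in> A" using card_ge by fastforce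
  define \<mu> where "\<mu> = c Q0 * ?l Q0 / lam Q0"
  have "power_relation e A (\<lambda>q. c q * ?l q + (- \<mu>) * lam q)"
    by (rule power_relation_add[OF rel power_relation_scale[OF relation]])
  from circuit[OF this Q0] have proportional: "c Q * ?l Q = \<mu> * lam Q" if "Q \<in> A" for Q
    using that lam_nonzero[OF Q0] by (simp add: \<mu>_def)
  have "\<mu> \<noteq> 0"
  proof
    assume "\<mu> = 0"
    then have z: "c q = 0 \<or> ?l q = 0" if "q \<in> A" for q
      using proportional[OF that] by simp
    define S where "S = insert P (insert P' {q \<in> A. ?l q = 0})"
    have "power_relation (Suc e) S c"
      by (rule power_relation_restrict[OF c]) (use finite z in \<open>auto simp: S_def\<close>)
    moreover have "card S \<le> Suc (Suc e)"
      using card_insert_le_m1[of 3 "{q \<in> A. ?l q = 0}" P'] few_on_line[OF a(1)] degree_ge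
        card_insert_le_m1[of 4 "insert P' {q \<in> A. ?l q = 0}" P]
      by (auto simp: S_def)
    ultimately have "c P = 0"
      using power_relation_few_points[of S "Suc e" c P] finite proj P by (auto simp: S_def)
    then show False using \<open>c P \<noteq> 0\<close> by simp
  qed
  then show "\<exists>\<mu>. \<mu> \<noteq> 0 \<and> (\<forall>Q\<in>A. c Q * ?l Q = \<mu> * lam Q)" using proportional by blast
qed

text \<open>Contracting \<open>c\<close> by \<open>g\<close> removes the terms from \<open>B\<close> and leaves a relation in degree \<open>e\<close> on \<open>A\<close>. It has
  a zero coefficient at \<open>Q0\<close>, so it vanishes.\<close>

lemma apolar_form_vanishes:
  assumes B: "finite B" and c: "power_relation (2 * e + 1) (A \<union> B) c"
    and nz: "\<forall>p\<in>A - B. c p \<noteq> 0"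
    and g: "homogeneous (Suc e) g" "\<And>p. p \<in> B \<Longrightarrow> g (rep_vec p) = 0"
    and Q0: "Q0 \<in> A" "g (rep_vec Q0) = 0" and Q: "Q \<in> A"
  shows "g (rep_vec Q) = 0"
proof -
  have "power_relation (Suc e + e) (A \<union> B) c" using c by (simp add: mult_2)
  from power_relation_times_homogeneous[OF g(1) this]
  have "power_relation e A (\<lambda>p. c p * g (rep_vec p))"
    by (rule power_relation_restrict) (use finite B g(2) in auto)
  from circuit[OF this Q0(1) _ Q] have "c Q * g (rep_vec Q) = 0" using Q0 by simp
  then show ?thesis using nz g(2)[of Q] Q by auto
qed

text \<open>By \<open>apolar_form_vanishes\<close> and duality, the powers of degree \<open>e + 1\<close> at all points of \<open>A \<union> B\<close> lie in
  the span of those at \<open>B\<close> and one point of \<open>A\<close>. These are at most \<open>card A + 1\<close> vectors, one less than the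
  number of points considered here.\<close>

lemma two_points_dependent:
  assumes B: "finite B" "card B \<le> card A" and c: "power_relation (2 * e + 1) (A \<union> B) c"
    and nz: "\<forall>p\<in>A - B. c p \<noteq> 0"
    and P: "P \<in> B - A" "P' \<in> B - A" "P \<noteq> P'"
  obtains c' where "power_relation (Suc e) (insert P (insert P' A)) c'"
    "\<exists>Q\<in>insert P (insert P' A). c' Q \<noteq> 0" "\<forall>Q. Q \<notin> insert P (insert P' A) \<longrightarrow> c' Q = 0"
proof -
  obtain Q0 where Q0: "Q0 \<in> A" using card_ge by fastforce
  define X where "X = insert P (insert P' A)"
  define K where "K = (\<lambda>p. linear_form (rep_vec p) ^ Suc e) ` insert Q0 B"
  have "linear_form (rep_vec Q) ^ Suc e \<in> form.span K" if "Q \<in> X" for Q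
  proof (rule ccontr)
    assume contra: "linear_form (rep_vec Q) ^ Suc e \<notin> form.span K"
    have "K = (\<lambda>y. linear_form y ^ Suc e) ` rep_vec ` insert Q0 B"
      by (simp add: K_def image_image)
    with contra have "linear_form (rep_vec Q) ^ Suc e
        \<notin> form.span ((\<lambda>y. linear_form y ^ Suc e) ` rep_vec ` insert Q0 B)" by simp
    from exists_homogeneous_separating[OF this] obtain g where g: "homogeneous (Suc e) g"
      "\<forall>y\<in>rep_vec ` insert Q0 B. g y = 0" "g (rep_vec Q) \<noteq> 0" by blast
    have "Q \<in> A" using that P g by (auto simp: X_def)
    then show False
      using apolar_form_vanishes[OF B(1) c nz g(1) _ Q0 _ \<open>Q \<in> A\<close>] g(2,3) by simp
  qed
  moreover have "card K < card X"
  proof -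
    have "card K \<le> card (insert Q0 B)" unfolding K_def using B by (intro card_image_le) simp
    also have "\<dots> \<le> Suc (card B)" by (rule card_insert_le_m1) auto
    also have "\<dots> < card X" using B P finite by (simp add: X_def)
    finally show ?thesis .
  qed
  moreover have "finite X" "finite K" using finite B by (auto simp: X_def K_def)
  ultimately obtain c0 where c0: "\<exists>x\<in>X. c0 x \<noteq> 0"
    "(\<Sum>p\<in>X. poly_scale (c0 p) (linear_form (rep_vec p) ^ Suc e)) = 0"
    using form.exists_linear_relation[of X K "\<lambda>p. linear_form (rep_vec p) ^ Suc e"] by blast
  define c' where "c' = (\<lambda>p. if p \<in> X then c0 p else 0)"
  have "power_relation (Suc e) X c'" "\<exists>Q\<in>X. c' Q \<noteq> 0" "\<forall>Q. Q \<notin> X \<longrightarrow> c' Q = 0"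
    using c0 by (auto simp: power_relation_def c'_def)
  then show ?thesis using that by (simp add: X_def)
qed

text \<open>Put \<open>\<tau> = y / x\<close>. The equation of the conic gives \<open>z / x = s \<tau> / (\<tau> - t)\<close>. So the linear form of a
  point of \<open>A\<close> is a multiple of \<open>(\<tau> - t) X + (\<tau> - t) \<tau> Y + s \<tau> Z\<close>, which is quadratic in \<open>\<tau>\<close>. Its
  \<open>e\<close>-th power has degree \<open>2 e\<close> in \<open>\<tau>\<close> and lies in the span of \<open>2 e + 1\<close> coefficients that do not depend on
  the point. This leaves room for a relation on \<open>A\<close> minus a point, which contradicts the circuit
  property.\<close>

lemma not_on_parametrised_conic:
  assumes lin: "\<And>v. linear_form v = poly_scale (x v) X + poly_scale (y v) Y + poly_scale (z v) Z"
    and s: "s \<noteq> 0"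
    and nz: "\<And>Q. Q \<in> A \<Longrightarrow> x (rep_vec Q) \<noteq> 0 \<and> y (rep_vec Q) \<noteq> 0 \<and> z (rep_vec Q) \<noteq> 0"
    and conic: "\<And>Q. Q \<in> A \<Longrightarrow> 1 / x (rep_vec Q) - t / y (rep_vec Q) = s / z (rep_vec Q)"
  shows False
proof -
  \<comment> \<open>Scalars become constant polynomials, so that \<open>G\<close> below is a polynomial in \<open>\<tau>\<close> over the ring of
    forms, and its evaluation is a ring homomorphism.\<close>
  define C where "C = (\<lambda>k. Poly_Mapping.single 0 k :: 3 cpoly)"
  have C: "poly_scale k f = C k * f" "C (k + l) = C k + C l" "C (k * l) = C k * C l" "C 1 = 1"
     for k l f
    by (simp_all add: C_def poly_scale_eq single_add mult_single)
  have Cpow: "C (k ^ i) = C k ^ i" for k i by (induction i) (simp_all add: C)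
  define G where "G = [: C (- t) * X, X + C (- t) * Y + C s * Z, Y :]"
  define K where "K = coeff (G ^ e) ` {..2 * e}"
  have "degree G \<le> 2" by (simp add: G_def)
  then have deg: "degree (G ^ e) \<le> 2 * e"
    using degree_power_le[of G e] mult_le_mono1[of "degree G" 2 e] by linarith
  have span: "linear_form (rep_vec Q) ^ e \<in> form.span K" if "Q \<in> A" for Q
  proof -
    define x' y' z' where "x' = x (rep_vec Q)" "y' = y (rep_vec Q)" "z' = z (rep_vec Q)"
    have nz': "x' \<noteq> 0" "y' \<noteq> 0" "z' \<noteq> 0" and con: "1 / x' - t / y' = s / z'"
      using nz[OF that] conic[OF that] by (auto simp: x'_y'_z'_def)
    define \<tau> where "\<tau> = y' / x'"
    have con': "(y' - t * x') * z' = s * x' * y'" using con nz' by (simp add: field_simps)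
    then have "y' - t * x' \<noteq> 0" using nz' s by auto
    then have \<tau>: "\<tau> - t \<noteq> 0" using nz' by (simp add: \<tau>_def field_simps)
    define k where "k = x' / (\<tau> - t)"
    have kx: "x' = k * (\<tau> - t)" using \<tau> by (simp add: k_def)
    have ky: "y' = k * ((\<tau> - t) * \<tau>)" using \<tau> nz' by (simp add: k_def \<tau>_def)
    have "(\<tau> - t) * z' = s * y'"
      using con' nz' by (simp add: \<tau>_def field_simps)
    then have kz: "z' = k * (s * \<tau>)"
      using \<tau> nz' by (simp add: k_def \<tau>_def field_simps)
    have Cd: "C (\<tau> - t) = C \<tau> + C (- t)" by (simp add: C(2)[symmetric])
    have "linear_form (rep_vec Q) = C x' * X + C y' * Y + C z' * Z"
      by (simp add: lin C x'_y'_z'_def)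
    also have "\<dots> = C k * poly G (C \<tau>)"
      unfolding kx ky kz C(3) Cd by (simp add: G_def algebra_simps)
    finally have "linear_form (rep_vec Q) ^ e = C (k ^ e) * poly (G ^ e) (C \<tau>)"
      by (simp add: power_mult_distrib Cpow)
    also have "poly (G ^ e) (C \<tau>) = (\<Sum>i\<le>2 * e. coeff (G ^ e) i * C \<tau> ^ i)"
      unfolding poly_altdef using deg by (intro sum.mono_neutral_left) (auto simp: coeff_eq_0)
    also have "\<dots> = (\<Sum>i\<le>2 * e. poly_scale (\<tau> ^ i) (coeff (G ^ e) i))"
      by (simp add: C Cpow mult.commute)
    finally have "linear_form (rep_vec Q) ^ e =
        poly_scale (k ^ e) (\<Sum>i\<le>2 * e. poly_scale (\<tau> ^ i) (coeff (G ^ e) i))"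
      by (simp only: C)
    then show ?thesis
      by (auto simp: K_def intro!: form.span_scale form.span_sum intro: form.span_base)
  qed
  obtain Q0 where Q0: "Q0 \<in> A" using card_ge by fastforce
  have "card K \<le> 2 * e + 1" using card_image_le[of "{..2 * e}" "coeff (G ^ e)"] by (simp add: K_def)
  also have "\<dots> < card (A - {Q0})" using card_ge Q0 finite by simp
  finally obtain c where c: "\<exists>p\<in>A - {Q0}. c p \<noteq> 0"
    "(\<Sum>p\<in>A - {Q0}. poly_scale (c p) (linear_form (rep_vec p) ^ e)) = 0"
    using form.exists_linear_relation[of "A - {Q0}" K "\<lambda>p. linear_form (rep_vec p) ^ e"] span finite
    by (auto simp: K_def)
  define c' where "c' = c(Q0 := 0)"
  have "power_relation e (A - {Q0}) c'"
    using c(2) by (simp add: power_relation_def c'_def)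
  then have "power_relation e A c'"
    using power_relation_restrict_iff[of A "A - {Q0}" c'] finite by (simp add: c'_def)
  moreover obtain p where "p \<in> A - {Q0}" "c p \<noteq> 0" using c(1) by blast
  ultimately show False using circuit[of c' Q0 p] Q0 by (simp add: c'_def)
qed

text \<open>Three points of \<open>B - A\<close> not on a line would give three relations in degree \<open>e + 1\<close>: \<open>c3\<close> on
  \<open>A \<union> {P1, P2}\<close>, \<open>c2\<close> on \<open>A \<union> {P1, P3}\<close>, and the combination \<open>r\<close> of both in which \<open>P1\<close> cancels,
  on \<open>A \<union> {P2, P3}\<close>. Each is \<open>lam\<close> divided by the equation of a side of the triangle, so \<open>r = c3 - t c2\<close>
  becomes the equation of a conic through \<open>A\<close>.\<close>

lemma extra_points_collinear:
  assumes B: "finite B" "B \<subseteq> proj_space" "card B \<le> card A"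
    and c: "power_relation (2 * e + 1) (A \<union> B) c"
    and nz: "\<forall>p\<in>A - B. c p \<noteq> 0"
  shows "vec.span (rep_vec ` (B - A)) \<noteq> UNIV"
proof
  assume span: "vec.span (rep_vec ` (B - A)) = UNIV"
  obtain S where S: "S \<subseteq> rep_vec ` (B - A)" "vec.independent S" "rep_vec ` (B - A) \<subseteq> vec.span S"
    using vec.maximal_independent_subset[of "rep_vec ` (B - A)"] by metis
  have "vec.span S = UNIV"
    using vec.span_mono[OF S(3)] span by (auto simp: vec.span_span)
  moreover have "card S = 3"
    using vec.basis_card_eq_dim[OF S(1,3,2)] span vec.dim_span[of "rep_vec ` (B - A)"]
      vec_dim_card[where 'n=3 and 'a=complex] by simp
  ultimately obtain x1 x2 x3 where x: "S = {x1, x2, x3}" "x1 \<noteq> x2" "x1 \<noteq> x3" "x2 \<noteq> x3"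
    "vec.span {x1, x2, x3} = UNIV" by (metis card_3_iff)
  obtain P1 P2 P3 where P: "P1 \<in> B - A" "P2 \<in> B - A" "P3 \<in> B - A"
    "x1 = rep_vec P1" "x2 = rep_vec P2" "x3 = rep_vec P3"
    using S(1) x(1) by auto
  have dist: "P1 \<noteq> P2" "P1 \<noteq> P3" "P2 \<noteq> P3" using x P by metis+
  have pr: "P1 \<in> proj_space - A" "P2 \<in> proj_space - A" "P3 \<in> proj_space - A"
    using P(1-3) B(2) by blast+
  have "vec.independent {x1, x2, x3}" using S(2) x(1) by simp
  then obtain a1 a2 a3 where a:
    "linear_functional a1 x1 = 1" "linear_functional a1 x2 = 0" "linear_functional a1 x3 = 0"
    "linear_functional a2 x1 = 0" "linear_functional a2 x2 = 1" "linear_functional a2 x3 = 0"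
    "linear_functional a3 x1 = 0" "linear_functional a3 x2 = 0" "linear_functional a3 x3 = 1"
    and exp: "\<forall>v. v = linear_functional a1 v *s x1 +
      linear_functional a2 v *s x2 + linear_functional a3 v *s x3"
    by (rule dual_basis_expansion[OF _ x(2-5)])
  have a0: "a1 \<noteq> 0" "a2 \<noteq> 0" "a3 \<noteq> 0" using a(1,5,9) by (auto simp: linear_functional_def)
  obtain c3 where c3: "power_relation (Suc e) (insert P1 (insert P2 A)) c3"
    "\<exists>Q\<in>insert P1 (insert P2 A). c3 Q \<noteq> 0" "\<forall>Q. Q \<notin> insert P1 (insert P2 A) \<longrightarrow> c3 Q = 0"
    by (rule two_points_dependent[OF B(1,3) c nz P(1,2) dist(1)])
  obtain c2 where c2: "power_relation (Suc e) (insert P1 (insert P3 A)) c2"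
    "\<exists>Q\<in>insert P1 (insert P3 A). c2 Q \<noteq> 0" "\<forall>Q. Q \<notin> insert P1 (insert P3 A) \<longrightarrow> c2 Q = 0"
    by (rule two_points_dependent[OF B(1,3) c nz P(1,3) dist(2)])
  have a': "linear_functional a3 (rep_vec P1) = 0" "linear_functional a3 (rep_vec P2) = 0"
    "linear_functional a2 (rep_vec P1) = 0" "linear_functional a2 (rep_vec P3) = 0"
    "linear_functional a1 (rep_vec P2) = 0" "linear_functional a1 (rep_vec P3) = 0"
    using a P by simp_all
  note t3 = two_extra_points[OF pr(1,2) dist(1) a0(3) a'(1,2) c3(1,2)]
  note t2 = two_extra_points[OF pr(1,3) dist(2) a0(2) a'(3,4) c2(1,2)]
  \<comment> \<open>The factor that cancels the coefficient at \<open>P1\<close>.\<close>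
  define t where "t = c3 P1 / c2 P1"
  define r where "r = (\<lambda>p. c3 p + (- t) * c2 p)"
  let ?Y = "insert P1 (insert P2 (insert P3 A))"
  have "power_relation (Suc e) ?Y c3"
    using power_relation_restrict_iff[of ?Y "insert P1 (insert P2 A)" c3 "Suc e"] c3(1,3) finite
    by blast
  moreover have "power_relation (Suc e) ?Y c2"
    using power_relation_restrict_iff[of ?Y "insert P1 (insert P3 A)" c2 "Suc e"] c2(1,3) finite
    by blast
  ultimately have "power_relation (Suc e) ?Y r"
    unfolding r_def by (intro power_relation_add[OF _ power_relation_scale])
  moreover have "r P1 = 0" using t2(1) by (simp add: r_def t_def)
  ultimately have r: "power_relation (Suc e) (insert P2 (insert P3 A)) r"
    using power_relation_restrict[of "Suc e" ?Y r "insert P2 (insert P3 A)"] finite by blast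
  have "c2 P2 = 0" using c2(3) dist P(2) by blast
  then have "r P2 \<noteq> 0" using t3(2) by (simp add: r_def)
  then have "\<exists>Q\<in>insert P2 (insert P3 A). r Q \<noteq> 0" by blast
  note t1 = two_extra_points[OF pr(2,3) dist(3) a0(1) a'(5,6) r this]
  obtain \<mu>1 where \<mu>1: "\<mu>1 \<noteq> 0" "\<forall>Q\<in>A. r Q * linear_functional a1 (rep_vec Q) = \<mu>1 * lam Q"
    using t1(3) by blast
  obtain \<mu>2 where \<mu>2: "\<mu>2 \<noteq> 0" "\<forall>Q\<in>A. c2 Q * linear_functional a2 (rep_vec Q) = \<mu>2 * lam Q"
    using t2(3) by blast
  obtain \<mu>3 where \<mu>3: "\<mu>3 \<noteq> 0" "\<forall>Q\<in>A. c3 Q * linear_functional a3 (rep_vec Q) = \<mu>3 * lam Q"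
    using t3(3) by blast
  have l: "linear_functional a3 (rep_vec Q) \<noteq> 0 \<and> linear_functional a2 (rep_vec Q) \<noteq> 0 \<and>
      linear_functional a1 (rep_vec Q) \<noteq> 0" if "Q \<in> A" for Q
    using \<mu>1 \<mu>2 \<mu>3 that lam_nonzero[OF that] by (metis mult_eq_0_iff)
  show False
  proof (rule not_on_parametrised_conic)
    show "linear_form v = poly_scale (linear_functional a3 v) (linear_form x3) +
      poly_scale (linear_functional a2 v) (linear_form x2) +
      poly_scale (linear_functional a1 v) (linear_form x1)" for v
      by (subst exp[rule_format, of v]) (simp add: linear_form_add linear_form_scale)
    show "\<mu>1 / \<mu>3 \<noteq> 0" using \<mu>1 \<mu>3 by simp
    show "1 / linear_functional a3 (rep_vec Q) - (t * \<mu>2 / \<mu>3) / linear_functional a2 (rep_vec Q)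
      = (\<mu>1 / \<mu>3) / linear_functional a1 (rep_vec Q)" if Q: "Q \<in> A" for Q
    proof -
      let ?l1 = "linear_functional a1 (rep_vec Q)"
      let ?l2 = "linear_functional a2 (rep_vec Q)"
      let ?l3 = "linear_functional a3 (rep_vec Q)"
      have "c3 Q = \<mu>3 * lam Q / ?l3" "c2 Q = \<mu>2 * lam Q / ?l2" "r Q = \<mu>1 * lam Q / ?l1"
        using l[OF Q] \<mu>1(2) \<mu>2(2) \<mu>3(2) Q by (simp_all add: eq_divide_eq)
      then have "\<mu>3 * lam Q / ?l3 - t * (\<mu>2 * lam Q / ?l2) = \<mu>1 * lam Q / ?l1"
        by (simp add: r_def)
      then have "lam Q * \<mu>3 * (1 / ?l3 - (t * \<mu>2 / \<mu>3) / ?l2) = lam Q * \<mu>3 * ((\<mu>1 / \<mu>3) / ?l1)"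
        using \<mu>3(1) by (simp add: right_diff_distrib mult_ac)
      moreover have "lam Q * \<mu>3 \<noteq> 0" using lam_nonzero[OF Q] \<mu>3(1) by simp
      ultimately show ?thesis unfolding mult_cancel_left by blast
    qed
  qed (rule l)
qed

text \<open>Contraction by a line containing \<open>B - A\<close> leaves a relation on \<open>A\<close> in degree \<open>2 e\<close>. It is zero since
  \<open>A\<close> is independent in degree \<open>e + 1 \<le> 2 e\<close>, and so \<open>A - B\<close> is on the line too. Neither difference has
  more than two points, and four points are independent.\<close>

theorem unique_support:
  assumes B: "finite B" "B \<subseteq> proj_space" "card B \<le> card A"
    and c: "power_relation (2 * e + 1) (A \<union> B) c"
    and nz: "\<forall>p\<in>A - B. c p \<noteq> 0"
  shows "B = A"
proof -
  obtain z where "z \<notin> vec.span (rep_vec ` (B - A))"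
    using extra_points_collinear[OF B c nz] by blast
  from exists_linear_functional[OF this] obtain a where
    a: "\<forall>s\<in>rep_vec ` (B - A). linear_functional a s = 0" "linear_functional a z = 1" by blast
  then have a0: "a \<noteq> 0" by (auto simp: linear_functional_def)
  let ?l = "\<lambda>q. linear_functional a (rep_vec q)"
  have "power_relation (Suc (2 * e)) (A \<union> B) c" using c by simp
  from power_relation_times_linear[OF this, of a]
  have rel: "power_relation (2 * e) A (\<lambda>p. c p * ?l p)"
    by (rule power_relation_restrict) (use finite B a in auto)
  have on_line: "c Q * ?l Q = 0" if Q: "Q \<in> A" for Q
  proof -
    have "rep_vec Q \<notin> vec.span {}" using rep_vec(1) proj Q by auto
    from exists_linear_functional[OF this] obtain b where b: "linear_functional b (rep_vec Q) = 1" by blast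
    \<comment> \<open>A power of a functional that does not vanish at \<open>Q\<close> lowers the degree from \<open>2 e\<close> to \<open>e + 1\<close>.\<close>
    have "power_relation ((e - 1) + Suc e) A (\<lambda>p. c p * ?l p)"
      using rel degree_ge by (simp add: mult_2)
    from power_relation_times_homogeneous[OF homogeneous_linear_power this, of b]
    have "power_relation (Suc e) (insert Q A)
        (\<lambda>p. c p * ?l p * linear_functional b (rep_vec p) ^ (e - 1))"
      using Q by (simp add: insert_absorb)
    from insert_independent[OF _ this, of Q]
    show ?thesis using b Q proj by auto
  qed
  have sub: "A - B \<subseteq> {q \<in> A. ?l q = 0}" using on_line nz by force
  have "card (A - B) \<le> 2"
    using card_mono[OF _ sub] few_on_line[OF a0] finite by fastforce
  moreover have "card (B - A) \<le> card (A - B)"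
    using card_Diff_subset_Int[of A B] card_Diff_subset_Int[of B A] B finite
      card_mono[of A "A \<inter> B"] card_mono[of B "A \<inter> B"] by (simp add: Int_commute)
  ultimately have BA: "card (B - A) \<le> 2" by simp
  define S where "S = {q \<in> A. ?l q = 0} \<union> (B - A)"
  have "card S \<le> 4"
    unfolding S_def using card_Un_le[of "{q \<in> A. ?l q = 0}" "B - A"] few_on_line[OF a0] BA by linarith
  moreover have "power_relation (2 * e + 1) S c"
    by (rule power_relation_restrict[OF c]) (use on_line finite B in \<open>auto simp: S_def\<close>)
  ultimately have "c p = 0" if "p \<in> S" for p
    using power_relation_few_points[of S "2 * e + 1" c p] that degree_ge finite B proj
    by (auto simp: S_def)
  then have "A - B = {}" using sub nz unfolding S_def by blast
  then show ?thesis using card_subset_eq[of B A] card_seteq[of B A] B by auto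
qed

end

section \<open>Kruskal ranks and decompositions as relations\<close>

lemma (in vector_space) kruskal_rank_max:
  assumes "finite X"
  shows "Y \<subseteq> X \<Longrightarrow> card Y \<le> kruskal_rank X \<Longrightarrow> proj_independent Y"
    and "kruskal_rank X < card X \<Longrightarrow> \<exists>Y\<subseteq>X. \<not> proj_independent Y"
proof -
  define S where "S = {k. k \<le> card X \<and> (\<forall>Y. Y \<subseteq> X \<and> card Y \<le> k \<longrightarrow> proj_independent Y)}"
  have S: "kruskal_rank X = Max S" by (simp add: kruskal_rank_def S_def)
  have fin: "finite S" by (rule finite_subset[of _ "{..card X}"]) (auto simp: S_def)
  have "proj_independent {}" by (simp add: proj_independent_def independent_empty)
  then have "0 \<in> S" using assms finite_subset[of _ X] by (auto simp: S_def)
  then have "kruskal_rank X \<in> S" using Max_in[OF fin] S by auto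
  then show "Y \<subseteq> X \<Longrightarrow> card Y \<le> kruskal_rank X \<Longrightarrow> proj_independent Y"
    unfolding S_def by blast
  show "\<exists>Y\<subseteq>X. \<not> proj_independent Y" if "kruskal_rank X < card X"
  proof (rule ccontr)
    assume "\<not> (\<exists>Y\<subseteq>X. \<not> proj_independent Y)"
    then have "card X \<in> S" by (auto simp: S_def)
    then have "card X \<le> Max S" using Max_ge[OF fin] by blast
    then show False using that S by simp
  qed
qed

lemma veronese_eq_span:
  assumes "p \<in> proj_space"
  shows "veronese d p = form.span {linear_form (rep_vec p) ^ d}"
  using veronese_span[of d "rep_vec p"] rep_vec(2)[OF assms] by simp

lemma inj_on_veronese:
  assumes "1 \<le> d"
  shows "inj_on (veronese d) (proj_space :: (complex ^ 'n::finite) set set)"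
proof (rule inj_onI, rule ccontr)
  fix p q :: "(complex ^ 'n) set"
  assume p: "p \<in> proj_space" and q: "q \<in> proj_space" and eq: "veronese d p = veronese d q" and ne: "p \<noteq> q"
  have "linear_form (rep_vec p) ^ d \<in> form.span {linear_form (rep_vec q) ^ d}"
    using eq form.span_base[of "linear_form (rep_vec p) ^ d" "{linear_form (rep_vec p) ^ d}"]
    unfolding veronese_eq_span[OF p] veronese_eq_span[OF q] by simp
  then obtain k where k: "linear_form (rep_vec p) ^ d = poly_scale k (linear_form (rep_vec q) ^ d)"
    by (auto simp: form.span_singleton)
  define c where "c = (\<lambda>x. if x = p then 1 else - k)"
  have "power_relation d {p, q} c"
    using ne by (simp add: power_relation_def c_def k)
  from power_relation_few_points[OF _ _ _ this, of p] have "c p = 0"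
    using p q assms ne by simp
  then show False by (simp add: c_def)
qed

text \<open>Passing from lines to chosen vectors: any two representatives of \<open>veronese d p\<close> differ by a nonzero
  scalar, so independence does not depend on the choice made by \<open>rep_vec\<close>.\<close>

lemma proj_independent_veronese_iff:
  assumes "finite X" "X \<subseteq> proj_space" "1 \<le> d"
  shows "form.proj_independent (veronese d ` X) \<longleftrightarrow>
    (\<forall>c. power_relation d X c \<longrightarrow> (\<forall>p\<in>X. c p = 0))"
proof -
  let ?L = "\<lambda>p. linear_form (rep_vec p) ^ d"
  have inj: "inj_on (veronese d) X"
    using inj_on_subset[OF inj_on_veronese[OF assms(3)] assms(2)] .
  have ver: "veronese d p = form.span {?L p}" if "p \<in> X" for p
    using veronese_eq_span assms(2) that by blast
  show ?thesis
  proof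
    assume "form.proj_independent (veronese d ` X)"
    then obtain rep where rep: "\<forall>p\<in>X. veronese d p = form.span {rep (veronese d p)}"
      and ind: "form.independent (rep ` veronese d ` X)"
      by (auto simp: form.proj_independent_def)
    define w where "w = (\<lambda>p. rep (veronese d p))"
    have w: "veronese d p = form.span {w p}" if "p \<in> X" for p
      using rep that by (simp add: w_def)
    have injw: "inj_on w X"
      using w inj by (metis inj_on_def)
    have "\<exists>k. ?L p = poly_scale k (w p)" if "p \<in> X" for p
    proof -
      have "?L p \<in> form.span {w p}"
        using form.span_base[of "?L p" "{?L p}"] ver[OF that] w[OF that] by simp
      then show ?thesis by (auto simp: form.span_singleton)
    qed
    then obtain k where k: "\<And>p. p \<in> X \<Longrightarrow> ?L p = poly_scale (k p) (w p)" by metis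
    have k0: "k p \<noteq> 0" if "p \<in> X" for p
    proof
      assume "k p = 0"
      then have "?L p = 0" using k[OF that] by simp
      then show False using linear_form_power_nonzero rep_vec(1) assms(2) that by blast
    qed
    show "\<forall>c. power_relation d X c \<longrightarrow> (\<forall>p\<in>X. c p = 0)"
    proof (intro allI impI ballI)
      fix c p assume c: "power_relation d X c" and p: "p \<in> X"
      have "(\<Sum>v\<in>w ` X. poly_scale (c (the_inv_into X w v) * k (the_inv_into X w v)) v)
          = (\<Sum>q\<in>X. poly_scale (c q * k q) (w q))"
        by (subst sum.reindex[OF injw]) (simp add: the_inv_into_f_f[OF injw])
      also have "\<dots> = (\<Sum>q\<in>X. poly_scale (c q) (?L q))"
        by (intro sum.cong) (simp_all add: k)
      also have "\<dots> = 0" using c by (simp add: power_relation_def)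
      finally have s: "(\<Sum>v\<in>w ` X. poly_scale (c (the_inv_into X w v) * k (the_inv_into X w v)) v) = 0" .
      have "form.independent (w ` X)" using ind by (simp add: w_def image_image)
      from form.independentD[OF this _ subset_refl s, of "w p"]
      have "c p * k p = 0" using p assms(1) by (simp add: the_inv_into_f_f[OF injw])
      then show "c p = 0" using k0[OF p] by simp
    qed
  next
    assume indep: "\<forall>c. power_relation d X c \<longrightarrow> (\<forall>p\<in>X. c p = 0)"
    have injL: "inj_on ?L X"
      using ver inj by (metis (no_types, lifting) inj_on_def)
    have "form.independent (?L ` X)"
      unfolding form.dependent_finite[OF finite_imageI[OF assms(1)]]
    proof clarify
      fix u p assume u: "(\<Sum>v\<in>?L ` X. poly_scale (u v) v) = 0" and p: "p \<in> X" "u (?L p) \<noteq> 0"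
      have "power_relation d X (\<lambda>p. u (?L p))"
        using u by (simp add: power_relation_def sum.reindex[OF injL])
      then show False using indep p by blast
    qed
    moreover have "(\<lambda>s. ?L (the_inv_into X (veronese d) s)) ` veronese d ` X = ?L ` X"
      unfolding image_image by (intro image_cong) (simp_all add: the_inv_into_f_f[OF inj])
    moreover have "veronese d p = form.span {?L (the_inv_into X (veronese d) (veronese d p))}"
      if "p \<in> X" for p
      unfolding the_inv_into_f_f[OF inj that] by (rule ver[OF that])
    ultimately show "form.proj_independent (veronese d ` X)"
      unfolding form.proj_independent_def
      by (intro exI[of _ "\<lambda>s. ?L (the_inv_into X (veronese d) s)"] conjI) (blast, simp only: simp_thms)
  qed
qed

text \<open>As the Veronese map is injective, subsets of \<open>A\<close> and of its image have the same cardinality. If the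
  Kruskal rank is less than \<open>card A\<close>, maximality gives a dependent subset, and its relation is extended to
  \<open>A\<close> by zero.\<close>

lemma kruskal_rank_deg_facts:
  assumes A: "finite A" "A \<subseteq> proj_space" "1 \<le> d"
  shows "Y \<subseteq> A \<Longrightarrow> card Y \<le> kruskal_rank_deg d A \<Longrightarrow> power_relation d Y c \<Longrightarrow> p \<in> Y \<Longrightarrow> c p = 0"
    and "kruskal_rank_deg d A < card A \<Longrightarrow> \<exists>c. power_relation d A c \<and> (\<exists>p\<in>A. c p \<noteq> 0)"
proof -
  have inj: "inj_on (veronese d) A"
    using inj_on_subset[OF inj_on_veronese[OF A(3)] A(2)] .
  have fin: "finite (veronese d ` A)" using A by simp
  note K = form.kruskal_rank_max[OF fin]
  show "c p = 0" if Y: "Y \<subseteq> A" "card Y \<le> kruskal_rank_deg d A" and c: "power_relation d Y c" "p \<in> Y"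
  proof -
    have "card (veronese d ` Y) = card Y"
      using card_image inj_on_subset[OF inj Y(1)] by blast
    then have "form.proj_independent (veronese d ` Y)"
      using K(1)[of "veronese d ` Y"] Y by (auto simp: kruskal_rank_deg_def)
    then show ?thesis
      using proj_independent_veronese_iff[of Y d] finite_subset[OF Y(1)] A Y(1) c by blast
  qed
  show "\<exists>c. power_relation d A c \<and> (\<exists>p\<in>A. c p \<noteq> 0)" if less: "kruskal_rank_deg d A < card A"
  proof -
    have "card (veronese d ` A) = card A" using card_image[OF inj] .
    then obtain Z where Z: "Z \<subseteq> veronese d ` A" "\<not> form.proj_independent Z"
      using K(2) less by (auto simp: kruskal_rank_deg_def)
    then obtain Y where Y: "Y \<subseteq> A" "Z = veronese d ` Y" by (metis subset_imageE)
    then obtain c p where c: "power_relation d Y c" "p \<in> Y" "c p \<noteq> 0"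
      using proj_independent_veronese_iff[of Y d] finite_subset[OF Y(1)] A Z by blast
    define c' where "c' = (\<lambda>q. if q \<in> Y then c q else 0)"
    have "power_relation d Y c'" using c(1) by (simp add: power_relation_def c'_def)
    then have "power_relation d A c'"
      using power_relation_restrict_iff[of A Y c' d] A Y by (simp add: c'_def)
    then show ?thesis using c Y by (intro exI[of _ c']) (auto simp: c'_def)
  qed
qed

text \<open>The vectors on which a nonzero functional vanishes form a space of dimension less than three.\<close>

lemma three_points_on_line_dependent:
  fixes Y :: "(complex ^ 3) set set"
  assumes "card Y = 3" "a \<noteq> 0" "\<And>p. p \<in> Y \<Longrightarrow> linear_functional a (rep_vec p) = 0"
  shows "\<exists>c. power_relation 1 Y c \<and> (\<exists>p\<in>Y. c p \<noteq> 0)"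
proof -
  define H where "H = {x. linear_functional a x = 0}"
  have sub: "vec.subspace H"
    unfolding vec.subspace_def H_def by (simp add: linear_functional_add linear_functional_scale)
  obtain i where i: "a $ i \<noteq> 0" using assms(2) by (auto simp: vec_eq_iff)
  have "linear_functional a (axis i 1) = a $ i"
    by (simp add: linear_functional_def axis_def if_distrib[of "\<lambda>z. _ * z"] cong: if_cong)
  then have "axis i 1 \<notin> H" using i by (simp add: H_def)
  then have "vec.span H \<subset> vec.span UNIV"
    unfolding iffD2[OF vec.span_eq_iff sub] vec.span_UNIV by blast
  then have "vec.dim H < vec.dim (UNIV :: (complex ^ 3) set)" by (rule vec.dim_psubset)
  then have "vec.dim H < 3" using vec_dim_card[where 'n=3 and 'a=complex] by simp
  moreover obtain K where K: "K \<subseteq> H" "vec.independent K" "H \<subseteq> vec.span K" "card K = vec.dim H"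
    using vec.basis_exists[of H] by metis
  ultimately have "card K < 3"
    by simp
  moreover have "finite K" using vec.finiteI_independent K(2) by blast
  moreover have "finite Y" using assms(1) card.infinite by fastforce
  ultimately obtain c where c: "\<exists>p\<in>Y. c p \<noteq> 0" "(\<Sum>p\<in>Y. c p *s rep_vec p) = 0"
    using vec.exists_linear_relation[of Y K rep_vec] assms K(3) by (auto simp: H_def)
  have "(\<Sum>p\<in>Y. poly_scale (c p) (linear_form (rep_vec p))) = linear_form (\<Sum>p\<in>Y. c p *s rep_vec p)"
    using \<open>finite Y\<close> by (simp add: linear_form_sum linear_form_scale)
  then show ?thesis using c by (auto simp: power_relation_def)
qed

lemma proj_span_veronese_iff:
  assumes "A \<subseteq> proj_space"
  shows "T \<in> form.proj_span (veronese d ` A) \<longleftrightarrow>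
    (\<exists>t. t \<noteq> 0 \<and> T = form.span {t} \<and> t \<in> form.span ((\<lambda>p. linear_form (rep_vec p) ^ d) ` A))"
proof -
  let ?L = "\<lambda>p. linear_form (rep_vec p) ^ d"
  have "form.span (\<Union> (veronese d ` A)) = form.span (?L ` A)"
  proof (rule antisym)
    have "veronese d p \<subseteq> form.span (?L ` A)" if "p \<in> A" for p
      using that assms veronese_eq_span[of p d] form.span_mono[of "{?L p}" "?L ` A"] by auto
    then show "form.span (\<Union> (veronese d ` A)) \<subseteq> form.span (?L ` A)"
      by (intro form.span_minimal) auto
    have "?L p \<in> veronese d p" if "p \<in> A" for p
      using that assms veronese_eq_span[of p d] form.span_base[of "?L p" "{?L p}"] by auto
    then show "form.span (?L ` A) \<subseteq> form.span (\<Union> (veronese d ` A))"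
      by (intro form.span_mono) auto
  qed
  then show ?thesis by (auto simp: form.proj_span_def form.projectivization_def)
qed

text \<open>Both decompositions express the same form \<open>t\<close>; the relation is the difference of the two expressions.
  By minimality of \<open>A\<close>, no coefficient in the expression over \<open>A\<close> is zero, so neither is the difference at a
  point outside \<open>B\<close>.\<close>

lemma decompositions_give_relation:
  assumes A: "minimal_decomposition d T A" and B: "decomposition d T B"
  shows "\<exists>c. power_relation d (A \<union> B) c \<and> (\<forall>p\<in>A - B. c p \<noteq> 0)"
proof -
  let ?L = "\<lambda>p. linear_form (rep_vec p) ^ d"
  have fin: "finite A" "finite B" and pr: "A \<subseteq> proj_space" "B \<subseteq> proj_space"
    using A B by (auto simp: minimal_decomposition_def decomposition_def)
  obtain t where t: "t \<noteq> 0" "T = form.span {t}" "t \<in> form.span (?L ` A)"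
    using A pr proj_span_veronese_iff[of A T d]
    by (auto simp: minimal_decomposition_def decomposition_def)
  obtain t' where t': "T = form.span {t'}" "t' \<in> form.span (?L ` B)"
    using B pr proj_span_veronese_iff[of B T d] by (auto simp: decomposition_def)
  have "t \<in> form.span {t'}" using t(2) t'(1) form.span_base[of t "{t}"] by simp
  then have tB: "t \<in> form.span (?L ` B)"
    using form.span_minimal[of "{t'}" "form.span (?L ` B)"] t'(2) by auto
  have notin: "t \<notin> form.span (?L ` (A - {p}))" if "p \<in> A" for p
  proof
    assume "t \<in> form.span (?L ` (A - {p}))"
    moreover have "A - {p} \<subseteq> proj_space" using pr by blast
    ultimately have "T \<in> form.proj_span (veronese d ` (A - {p}))"
      using proj_span_veronese_iff t(1,2) by blast
    moreover have "A - {p} \<subset> A" using that by blast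
    ultimately show False using A by (auto simp: minimal_decomposition_def)
  qed
  have comb: "\<exists>a. t = (\<Sum>p\<in>X. poly_scale (a p) (?L p))" if "finite X" "t \<in> form.span (?L ` X)" for X
    using that(2)
  proof (induction rule: form.span_induct_alt)
    case base
    show ?case by (intro exI[of _ "\<lambda>_. 0"]) simp
  next
    case (step k x y)
    then obtain a q where a: "y = (\<Sum>p\<in>X. poly_scale (a p) (?L p))" and q: "q \<in> X" "x = ?L q" by blast
    have "(\<Sum>p\<in>X. poly_scale (if p = q then k else 0) (?L p)) = (\<Sum>p\<in>{q}. poly_scale k (?L p))"
      using q that(1) by (intro sum.mono_neutral_cong_right) auto
    then have "poly_scale k x + y = (\<Sum>p\<in>X. poly_scale ((if p = q then k else 0) + a p) (?L p))"
      by (simp add: a q form.scale_left_distrib sum.distrib)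
    then show ?case by (intro exI)
  qed
  obtain a where a: "t = (\<Sum>p\<in>A. poly_scale (a p) (?L p))" using comb[OF fin(1) t(3)] by blast
  obtain b where b: "t = (\<Sum>p\<in>B. poly_scale (b p) (?L p))" using comb[OF fin(2) tB] by blast
  have a0: "a p \<noteq> 0" if "p \<in> A" for p
  proof
    assume "a p = 0"
    then have "t = (\<Sum>q\<in>A - {p}. poly_scale (a q) (?L q))"
      using a fin that by (simp add: sum.remove[of A p])
    also have "\<dots> \<in> form.span (?L ` (A - {p}))"
      by (intro form.span_sum form.span_scale form.span_base) auto
    finally show False using notin[OF that] by simp
  qed
  define c where "c = (\<lambda>p. (if p \<in> A then a p else 0) - (if p \<in> B then b p else 0))"
  have "(\<Sum>p\<in>A \<union> B. poly_scale (if p \<in> A then a p else 0) (?L p)) = t"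
    unfolding a using fin by (intro sum.mono_neutral_cong_right) auto
  moreover have "(\<Sum>p\<in>A \<union> B. poly_scale (if p \<in> B then b p else 0) (?L p)) = t"
    unfolding b using fin by (intro sum.mono_neutral_cong_right) auto
  ultimately have "power_relation d (A \<union> B) c"
    by (simp add: power_relation_def c_def form.scale_left_diff_distrib sum_subtractf)
  moreover have "\<forall>p\<in>A - B. c p \<noteq> 0" using a0 by (simp add: c_def)
  ultimately show ?thesis by blast
qed

section \<open>Uniqueness of the decomposition\<close>

theorem proposition6p4:
  fixes q d r :: nat
    and T :: "3 cpoly set"
    and A C :: "(complex ^ 3) set set"
  assumes "d = 7 + 2 * q"
    and "T \<in> form.projectivization (forms d)"
    and "minimal_decomposition d T A"
    and "r = card A" and "r = 3 * q + 10"
    and "plane_curve 3 C" and "A \<subseteq> C"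
    and "kruskal_rank_deg 1 A = 3"
    and "kruskal_rank_deg (q + 3) A = 3 * q + 9"
  shows "\<not> (\<exists>B. minimal_decomposition d T B \<and> B \<noteq> A \<and> card B \<le> 3 * q + 10)"
proof clarify
  fix B assume B: "minimal_decomposition d T B" "B \<noteq> A" "card B \<le> 3 * q + 10"
  have A: "finite A" "A \<subseteq> proj_space" and B': "finite B" "B \<subseteq> proj_space" "decomposition d T B"
    using assms(3) B(1) by (auto simp: minimal_decomposition_def decomposition_def)
  have cardA: "card A = 3 * q + 10" using assms(4,5) by simp
  obtain lam p0 where lam: "power_relation (q + 3) A lam" "p0 \<in> A" "lam p0 \<noteq> 0"
    using kruskal_rank_deg_facts(2)[of A "q + 3"] A cardA assms(9) by auto
  have circuit: "c p' = 0"
    if c: "power_relation (q + 3) A c" and p: "p \<in> A" "c p = 0" and p': "p' \<in> A" for c p p'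
  proof (cases "p' = p")
    case False
    have "power_relation (q + 3) (A - {p}) c"
      by (rule power_relation_restrict[OF c]) (use A p in auto)
    moreover have "card (A - {p}) \<le> kruskal_rank_deg (q + 3) A" using cardA A p assms(9) by simp
    moreover have "p' \<in> A - {p}" using False p' by simp
    ultimately show ?thesis using kruskal_rank_deg_facts(1)[of A "q + 3" "A - {p}" c p'] A by simp
  qed (use p in simp)
  have line: "card {p \<in> A. linear_functional a (rep_vec p) = 0} \<le> 2" if a: "a \<noteq> 0" for a
  proof (rule ccontr)
    assume "\<not> ?thesis"
    then have "3 \<le> card {p \<in> A. linear_functional a (rep_vec p) = 0}" by simp
    from obtain_subset_with_card_n[OF this] obtain Y where
      Y: "Y \<subseteq> {p \<in> A. linear_functional a (rep_vec p) = 0}" "card Y = 3" by blast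
    then obtain c p where "power_relation 1 Y c" "p \<in> Y" "c p \<noteq> 0"
      using three_points_on_line_dependent[of Y a] a by blast
    moreover have "Y \<subseteq> A" using Y by blast
    ultimately show False
      using kruskal_rank_deg_facts(1)[of A 1 Y c p] A assms(8) Y(2) by simp
  qed
  interpret plane_circuit "q + 3" A lam
  proof
    show "lam p \<noteq> 0" if "p \<in> A" for p using circuit[OF lam(1) that _ lam(2)] lam(3) by blast
    show "power_relation (q + 3) A lam" by (rule lam(1))
    show "c p' = 0" if "power_relation (q + 3) A c" "p \<in> A" "c p = 0" "p' \<in> A" for c p p'
      using that by (rule circuit)
    show "card {p \<in> A. linear_functional a (rep_vec p) = 0} \<le> 2" if "a \<noteq> 0" for a
      using that by (rule line)
  qed (use A cardA in simp_all)
  obtain c where "power_relation d (A \<union> B) c" "\<forall>p\<in>A - B. c p \<noteq> 0"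
    using decompositions_give_relation[OF assms(3) B'(3)] by blast
  moreover have "d = 2 * (q + 3) + 1" using assms(1) by simp
  ultimately have "B = A" using unique_support[of B c] B' B(3) cardA by simp
  then show False using B(2) by simp
qed

end
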